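(* Let $A^{(1)},\dots,A^{(K)}\in\mathbb{R}^{n\times n}$ be symmetric matrices, let $\boldsymbol{p}_k=[\underline{p}_k,\overline{p}_k]$, $k=1,\dots,K$, be compact real intervals, and let $\boldsymbol{p}=\boldsymbol{p}_1\times\dots\times\boldsymbol{p}_K$. For $p\in\mathbb{R}^K$ let $A(p)=\sum_{k=1}^K A^{(k)}p_k$. The following are equivalent: (1) $A(p)$ is positive semidefinite for each $p\in\boldsymbol{p}$; (2) $A(p)$ is positive semidefinite for each $p$ such that $p_k\in\{\underline{p}_k,\overline{p}_k\}$ for all $k=1,\dots,K$; (3) $x^TA(p^c)x-\sum_{k=1}^K|x^TA^{(k)}x|\cdot p^\Delta_k\geq 0$ for each $x\in\mathbb{R}^n$.
   Context: For intervals $\boldsymbol{p}_k=[\underline{p}_k,\overline{p}_k]$ with $\underline{p}_k\le\overline{p}_k$, the midpoint vector $p^c$ and radius vector $p^\Delta$ are given by $p^c_k=\frac12(\underline{p}_k+\overline{p}_k)$ and $p^\Delta_k=\frac12(\overline{p}_k-\underline{p}_k)$, $k=1,\dots,K$. Positive semidefinite refers to real symmetric matrices. *)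

theory Defs
  imports "HOL-Analysis.Analysis"
begin

definition pos_semidef :: "real ^ 'n ^ 'n \<Rightarrow> bool" where
  "pos_semidef M \<longleftrightarrow> transpose M = M \<and> (\<forall>x. 0 \<le> x \<bullet> (M *v x))"

definition param_matrix :: "('k::finite \<Rightarrow> real ^ 'n ^ 'n) \<Rightarrow> real ^ 'k \<Rightarrow> real ^ 'n ^ 'n" where
  "param_matrix A p = (\<Sum>k\<in>UNIV. p $ k *\<^sub>R A k)"

text \<open>The interval vector with lower bounds \<open>l\<close> and upper bounds \<open>u\<close> is the box \<open>cbox l u\<close>
  (for \<open>real ^ 'k\<close> the library's \<open>cbox\<close> is the product of the intervals \<open>{l $ k..u $ k}\<close>).\<close>

definition interval_mid :: "real ^ 'k \<Rightarrow> real ^ 'k \<Rightarrow> real ^ 'k" where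
  "interval_mid l u = (\<chi> k. (l $ k + u $ k) / 2)"

definition interval_rad :: "real ^ 'k \<Rightarrow> real ^ 'k \<Rightarrow> real ^ 'k" where
  "interval_rad l u = (\<chi> k. (u $ k - l $ k) / 2)"

end

theory Submission
  imports Defs
begin

text \<open>
  For a fixed vector \<open>x\<close> the number \<open>x \<bullet> (param_matrix A p *v x)\<close> is a linear function
  \<open>\<Sum>k. p $ k * c k\<close> of the parameter, with coefficients \<open>c k = x \<bullet> (A k *v x)\<close>.
  A linear function on a box is minimised one coordinate at a time: take the lower endpoint where
  \<open>c k \<ge> 0\<close> and the upper endpoint where \<open>c k < 0\<close>. The minimum is thus attained at a vertex, and its
  value is the value at the midpoint minus \<open>\<Sum>k. \<bar>c k\<bar> * rad k\<close>, which is the left-hand side of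
  the third condition (\<open>linear_box_lower_bound\<close> and \<open>linear_box_minimum_at_vertex\<close>).
  Hence, for every \<open>x\<close>, nonnegativity on the box, nonnegativity at the vertices and nonnegativity of
  that expression say the same thing; the symmetry part of semidefiniteness is inherited from the
  matrices \<open>A k\<close>. The minimising vertex depends on \<open>x\<close>, which is why the second
  condition has to range over all vertices.
\<close>

lemma quadratic_form_param_matrix:
  "x \<bullet> (param_matrix A p *v x) = (\<Sum>k\<in>UNIV. p $ k * (x \<bullet> (A k *v x)))"
proof -
  have "(\<Sum>k\<in>S. p $ k *\<^sub>R A k) *v x = (\<Sum>k\<in>S. p $ k *\<^sub>R (A k *v x))" for S
    by (induction S rule: infinite_finite_induct)
       (simp_all add: matrix_vector_mult_add_rdistrib scaleR_matrix_vector_assoc)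
  then show ?thesis
    by (simp add: param_matrix_def inner_sum_right)
qed

lemma transpose_param_matrix:
  assumes "\<And>k. transpose (A k) = A k"
  shows "transpose (param_matrix A p) = param_matrix A p"
proof -
  have "A k $ i $ j = A k $ j $ i" for k i j
    using assms[of k] by (metis transpose_def vec_lambda_beta)
  then show ?thesis
    by (simp add: param_matrix_def transpose_def vec_eq_iff)
qed

text \<open>A point of the box differs from the midpoint by at most the radius in each coordinate, so
  the \<open>k\<close>-th term of the sum falls below its midpoint value by at most \<open>\<bar>c k\<bar>\<close> times the radius.\<close>

lemma linear_box_lower_bound:
  fixes c :: "'k::finite \<Rightarrow> real"
  assumes "p \<in> cbox l u"
  shows "(\<Sum>k\<in>UNIV. interval_mid l u $ k * c k) - (\<Sum>k\<in>UNIV. \<bar>c k\<bar> * interval_rad l u $ k)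
    \<le> (\<Sum>k\<in>UNIV. p $ k * c k)"
proof -
  have "interval_mid l u $ k * c k - \<bar>c k\<bar> * interval_rad l u $ k \<le> p $ k * c k" for k
  proof -
    have "l $ k \<le> p $ k" "p $ k \<le> u $ k"
      using assms by (simp_all add: mem_box_cart)
    then have "\<bar>interval_mid l u $ k - p $ k\<bar> \<le> interval_rad l u $ k"
      by (simp add: interval_mid_def interval_rad_def abs_le_iff field_simps)
    then have "\<bar>c k\<bar> * \<bar>interval_mid l u $ k - p $ k\<bar> \<le> \<bar>c k\<bar> * interval_rad l u $ k"
      by (intro mult_left_mono) auto
    moreover have "c k * (interval_mid l u $ k - p $ k)
        \<le> \<bar>c k\<bar> * \<bar>interval_mid l u $ k - p $ k\<bar>"
      by (metis abs_ge_self abs_mult)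
    ultimately show ?thesis
      by (simp add: algebra_simps)
  qed
  then show ?thesis
    by (simp flip: sum_subtractf add: sum_mono)
qed

text \<open>The lower bound is attained by choosing the endpoint in each coordinate according to the sign of
  the coefficient: midpoint minus radius is the lower endpoint, midpoint plus radius the upper one.\<close>

lemma linear_box_minimum_at_vertex:
  fixes c :: "'k::finite \<Rightarrow> real"
  obtains p where "\<And>k. p $ k \<in> {l $ k, u $ k}"
    and "(\<Sum>k\<in>UNIV. p $ k * c k)
      = (\<Sum>k\<in>UNIV. interval_mid l u $ k * c k) - (\<Sum>k\<in>UNIV. \<bar>c k\<bar> * interval_rad l u $ k)"
proof
  define p where "p = (\<chi> k. if 0 \<le> c k then l $ k else u $ k)"
  show "p $ k \<in> {l $ k, u $ k}" for k
    by (simp add: p_def)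
  have "p $ k * c k = interval_mid l u $ k * c k - \<bar>c k\<bar> * interval_rad l u $ k" for k
    by (simp add: p_def interval_mid_def interval_rad_def field_simps)
  then show "(\<Sum>k\<in>UNIV. p $ k * c k)
      = (\<Sum>k\<in>UNIV. interval_mid l u $ k * c k) - (\<Sum>k\<in>UNIV. \<bar>c k\<bar> * interval_rad l u $ k)"
    by (simp add: sum_subtractf)
qed

theorem theorem3:
  fixes A :: "'k::finite \<Rightarrow> real ^ 'n::finite ^ 'n"
    and l u :: "real ^ 'k"
  assumes sym: "\<And>k. transpose (A k) = A k"
    and le: "\<And>k. l $ k \<le> u $ k"
  defines "cond1 \<equiv> \<forall>p \<in> cbox l u. pos_semidef (param_matrix A p)"
    and "cond2 \<equiv> \<forall>p. (\<forall>k. p $ k \<in> {l $ k, u $ k}) \<longrightarrow> pos_semidef (param_matrix A p)"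
    and "cond3 \<equiv> \<forall>x :: real ^ 'n.
      x \<bullet> (param_matrix A (interval_mid l u) *v x)
        - (\<Sum>k\<in>UNIV. \<bar>x \<bullet> (A k *v x)\<bar> * interval_rad l u $ k) \<ge> 0"
  shows "(cond1 \<longleftrightarrow> cond2) \<and> (cond2 \<longleftrightarrow> cond3)"
proof -
  have cond1_imp_cond2: cond2 if cond1
    unfolding cond2_def
  proof (intro allI impI)
    fix p assume "\<forall>k. p $ k \<in> {l $ k, u $ k}"
    then have "l $ k \<le> p $ k \<and> p $ k \<le> u $ k" for k
      using le[of k] by (metis empty_iff insert_iff order_refl)
    then have "p \<in> cbox l u"
      by (simp add: mem_box_cart)
    with that show "pos_semidef (param_matrix A p)"
      by (simp add: cond1_def)
  qed
  have cond2_imp_cond3: cond3 if cond2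
    unfolding cond3_def
  proof
    fix x :: "real ^ 'n"
    obtain p where vertex: "\<And>k. p $ k \<in> {l $ k, u $ k}"
      and min: "(\<Sum>k\<in>UNIV. p $ k * (x \<bullet> (A k *v x)))
        = (\<Sum>k\<in>UNIV. interval_mid l u $ k * (x \<bullet> (A k *v x)))
          - (\<Sum>k\<in>UNIV. \<bar>x \<bullet> (A k *v x)\<bar> * interval_rad l u $ k)"
      using linear_box_minimum_at_vertex[where l = l and u = u and c = "\<lambda>k. x \<bullet> (A k *v x)"]
      by blast
    have "0 \<le> x \<bullet> (param_matrix A p *v x)"
      using that vertex by (simp add: cond2_def pos_semidef_def)
    with min show "x \<bullet> (param_matrix A (interval_mid l u) *v x)
        - (\<Sum>k\<in>UNIV. \<bar>x \<bullet> (A k *v x)\<bar> * interval_rad l u $ k) \<ge> 0"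
      by (simp add: quadratic_form_param_matrix)
  qed
  have cond3_imp_cond1: cond1 if cond3
    unfolding cond1_def pos_semidef_def
  proof (intro ballI conjI allI)
    fix p x assume "p \<in> cbox l u"
    then show "0 \<le> x \<bullet> (param_matrix A p *v x)"
      using that linear_box_lower_bound[of p l u "\<lambda>k. x \<bullet> (A k *v x)"]
      unfolding cond3_def quadratic_form_param_matrix by (meson order_trans)
  qed (rule transpose_param_matrix[OF sym])
  show ?thesis
    using cond1_imp_cond2 cond2_imp_cond3 cond3_imp_cond1 by blast
qed

end
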